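(* Let $\Omega\subset\mathbb{R}^n$ be bounded, let $\boldsymbol{x}_1,\ldots,\boldsymbol{x}_r\in\Omega$ ($r\ge 1$) be sensor locations, which we write as $x_1,\dots,x_r$, and let $\Delta=\sup_{x\in\Omega}\min_{1\le j\le r}\|x-x_j\|$. Let $u:\Omega\to\mathbb{R}$ and $\hat u:\Omega\times\mathbb{R}^{P}\to\mathbb{R}$, $(x,\theta)\mapsto\hat u(x,\theta)$, satisfy: (1) $u$ and $\hat u$ are Lipschitz continuous with respect to $x$, with smallest Lipschitz constants $L_u$ and $L_{\hat u}$ respectively, that is, $|u(x)-u(x')|\le L_u\|x-x'\|$ and $|\hat u(x,\theta)-\hat u(x',\theta)|\le L_{\hat u}\|x-x'\|$ for all $x,x'\in\Omega$ and all $\theta\in\mathbb{R}^P$; (2) there is a sequence of parameters $\theta^{(1)},\theta^{(2)},\ldots\in\mathbb{R}^P$ such that $\lim_{k\to\infty}|\hat u(x_j,\theta^{(k)})-u(x_j)|=0$ for every $j\in\{1,\ldots,r\}$. Let $\epsilon>0$ and assume that the sensors are distributed such that $\Delta<\dfrac{\epsilon}{2(L_u+L_{\hat u})}$. Then there exists $K\in\mathbb{N}$ such that for every $k>K$, $$\sup_{x\in\Omega}\left|\hat u(x,\theta^{(k)})-u(x)\right|<\epsilon.$$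
   Context: Here $u$ is the true (unknown) state at a frozen time, observed without noise at the sensor locations $x_1,\dots,x_r$, and $\hat u(\cdot,\theta)$ is a parametrized approximation (shape-morphing solution) with parameter vector $\theta\in\mathbb{R}^P$, where $P$ is the total number of parameters. $\|\cdot\|$ is the Euclidean norm on $\mathbb{R}^n$. The quantity $\Delta$ is the largest distance from a point of $\Omega$ to its closest sensor. The Lipschitz constant $L_{\hat u}$ is a single constant, valid for all parameter values $\theta$. *)

theory Defs
  imports "HOL-Analysis.Analysis"
begin

(* Largest distance from a point of S to its closest sensor among X 1, ..., X r.
   The real-valued supremum is the intended one for S bounded and nonempty, r >= 1. *)
definition sensor_gap :: "('a::real_normed_vector) set \<Rightarrow> (nat \<Rightarrow> 'a) \<Rightarrow> nat \<Rightarrow> real" where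
  "sensor_gap S X r = (SUP x\<in>S. MIN j\<in>{1..r}. norm (x - X j))"

(* Smallest constant that is a Lipschitz constant on S of every member of the family F.
   Lipschitz constants are nonnegative by definition of lipschitz_on, so the smallest one
   of a function on a singleton is 0. *)
definition smallest_lipschitz_const ::
  "('a::metric_space) set \<Rightarrow> ('a \<Rightarrow> 'b::metric_space) set \<Rightarrow> real \<Rightarrow> bool" where
  "smallest_lipschitz_const S F L \<longleftrightarrow>
     (\<forall>f\<in>F. L-lipschitz_on S f) \<and> (\<forall>M. (\<forall>f\<in>F. M-lipschitz_on S f) \<longrightarrow> L \<le> M)"

end

theory Submission
  imports Defs
begin

text \<open>
  The error \<open>e\<^sub>k(x) = uh x (\<theta> k) - u x\<close> is a difference of two Lipschitz functions, so it has
  Lipschitz constant \<open>L_u + L_uh\<close>, the same for every \<open>k\<close>. Every point of the domain lies within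
  the sensor gap \<open>\<Delta>\<close> of some sensor (\<open>nearest_sensor_within_gap\<close>), and hence
  \<open>\<bar>e\<^sub>k(x)\<bar> \<le> \<bar>e\<^sub>k(x\<^sub>j)\<bar> + (L_u + L_uh) \<Delta>\<close> for a nearest sensor \<open>x\<^sub>j\<close>
  (\<open>lipschitz_difference_bound\<close>). The second summand is smaller than \<open>\<epsilon>/2\<close>,
  uniformly in \<open>k\<close>: by the density of the sensors, or because it vanishes when both Lipschitz
  constants are zero. As there are only finitely many sensors, the errors at all of them are
  below \<open>\<epsilon>/2\<close> from a common index on. The resulting bound \<open>\<epsilon>/2 + (L_u + L_uh) \<Delta>\<close> does not depend
  on \<open>x\<close> and is strictly below \<open>\<epsilon>\<close>, so the strict inequality survives the supremum.
\<close>

text \<open>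
  The minimum over the finitely many sensors is attained, and it is at most the supremum that defines
  the gap. Boundedness makes that real-valued supremum an actual upper bound: distances to the
  first sensor bound the minimum.
\<close>
lemma nearest_sensor_within_gap:
  fixes S :: "'a::real_normed_vector set"
  assumes "bounded S" "r \<ge> 1" "x \<in> S"
  shows "\<exists>j\<in>{1..r}. norm (x - X j) \<le> sensor_gap S X r"
proof -
  let ?d = "\<lambda>y. MIN j\<in>{1..r}. norm (y - X j)"
  have one: "1 \<in> {1..r}"
    using \<open>r \<ge> 1\<close> by simp
  obtain B where B: "\<And>y. y \<in> S \<Longrightarrow> norm y \<le> B"
    using \<open>bounded S\<close> unfolding bounded_iff by blast
  have "?d y \<le> B + norm (X 1)" if "y \<in> S" for y
  proof -
    have "?d y \<le> norm (y - X 1)"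
      using one by (intro Min_le) auto
    also have "\<dots> \<le> norm y + norm (X 1)"
      by (rule norm_triangle_ineq4)
    finally show ?thesis
      using B[OF that] by simp
  qed
  then have "bdd_above (?d ` S)"
    by (intro bdd_aboveI2)
  then have gap: "?d x \<le> sensor_gap S X r"
    unfolding sensor_gap_def using \<open>x \<in> S\<close> by (intro cSUP_upper)
  have "?d x \<in> (\<lambda>j. norm (x - X j)) ` {1..r}"
    using one by (intro Min_in) auto
  then show ?thesis
    using gap by (metis (no_types, lifting) imageE)
qed

lemma lipschitz_difference_bound:
  fixes f g :: "'a::real_normed_vector \<Rightarrow> real"
  assumes "L-lipschitz_on S f" "M-lipschitz_on S g" "x \<in> S" "y \<in> S"
  shows "\<bar>f x - g x\<bar> \<le> \<bar>f y - g y\<bar> + (L + M) * norm (x - y)"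
proof -
  have "\<bar>f x - f y\<bar> \<le> L * norm (x - y)" "\<bar>g x - g y\<bar> \<le> M * norm (x - y)"
    using lipschitz_onD[OF assms(1,3,4)] lipschitz_onD[OF assms(2,3,4)]
    by (simp_all add: dist_norm)
  then show ?thesis
    by (simp add: distrib_right)
qed

theorem theorem1:
  fixes \<Omega> :: "(real ^ 'n) set"
    and X :: "nat \<Rightarrow> real ^ 'n"
    and r :: nat
    and u :: "real ^ 'n \<Rightarrow> real"
    and uh :: "real ^ 'n \<Rightarrow> real ^ 'p \<Rightarrow> real"
    and L_u L_uh \<epsilon> :: real
    and \<theta> :: "nat \<Rightarrow> real ^ 'p"
  assumes "bounded \<Omega>"
    and "r \<ge> 1"
    and "\<And>j. j \<in> {1..r} \<Longrightarrow> X j \<in> \<Omega>"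
    and "smallest_lipschitz_const \<Omega> {u} L_u"
    and "smallest_lipschitz_const \<Omega> (range (\<lambda>\<tau> x. uh x \<tau>)) L_uh"
    and "\<And>j. j \<in> {1..r} \<Longrightarrow> (\<lambda>k. \<bar>uh (X j) (\<theta> k) - u (X j)\<bar>) \<longlonglongrightarrow> 0"
    and "\<epsilon> > 0"
    and "L_u + L_uh \<noteq> 0 \<Longrightarrow> sensor_gap \<Omega> X r < \<epsilon> / (2 * (L_u + L_uh))"
  shows "\<exists>K::nat. \<forall>k>K. (SUP x\<in>\<Omega>. \<bar>uh x (\<theta> k) - u x\<bar>) < \<epsilon>"
proof -
  let ?L = "L_u + L_uh"
  let ?\<Delta> = "sensor_gap \<Omega> X r"
  have lip_u: "L_u-lipschitz_on \<Omega> u"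
    using assms(4) by (simp add: smallest_lipschitz_const_def)
  have lip_uh: "L_uh-lipschitz_on \<Omega> (\<lambda>x. uh x \<tau>)" for \<tau>
    using assms(5) by (auto simp: smallest_lipschitz_const_def)
  have L_nonneg: "0 \<le> ?L"
    using lipschitz_on_nonneg[OF lip_u] lipschitz_on_nonneg[OF lip_uh] by simp
  have half: "?L * ?\<Delta> < \<epsilon> / 2"
  proof (cases "?L = 0")
    case True
    then show ?thesis
      using \<open>\<epsilon> > 0\<close> by simp
  next
    case False
    then have "0 < ?L"
      using L_nonneg by linarith
    then show ?thesis
      using assms(8)[OF False] by (simp add: field_simps)
  qed
  have "\<forall>\<^sub>F k in sequentially. \<forall>j\<in>{1..r}. \<bar>uh (X j) (\<theta> k) - u (X j)\<bar> < \<epsilon> / 2"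
    using assms(6) \<open>\<epsilon> > 0\<close>
    by (intro eventually_ball_finite ballI order_tendstoD(2)[where y = 0]) auto
  then obtain K where K:
    "\<And>k j. \<lbrakk>k \<ge> K; j \<in> {1..r}\<rbrakk> \<Longrightarrow> \<bar>uh (X j) (\<theta> k) - u (X j)\<bar> < \<epsilon> / 2"
    unfolding eventually_sequentially by blast
  have "(SUP x\<in>\<Omega>. \<bar>uh x (\<theta> k) - u x\<bar>) < \<epsilon>" if "k > K" for k
  proof -
    have "\<bar>uh x (\<theta> k) - u x\<bar> \<le> \<epsilon> / 2 + ?L * ?\<Delta>" if x: "x \<in> \<Omega>" for x
    proof -
      obtain j where j: "j \<in> {1..r}" "norm (x - X j) \<le> ?\<Delta>"
        using nearest_sensor_within_gap[OF assms(1,2) x] by blast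
      have "\<bar>uh x (\<theta> k) - u x\<bar>
          \<le> \<bar>uh (X j) (\<theta> k) - u (X j)\<bar> + (L_uh + L_u) * norm (x - X j)"
        using lipschitz_difference_bound[OF lip_uh lip_u x assms(3)[OF j(1)]] .
      also have "\<dots> \<le> \<epsilon> / 2 + ?L * ?\<Delta>"
        using K[OF less_imp_le[OF \<open>k > K\<close>] j(1)] mult_left_mono[OF j(2) L_nonneg]
        by (simp add: add.commute)
      finally show ?thesis .
    qed
    moreover have "\<Omega> \<noteq> {}"
      using assms(2) assms(3)[of 1] by auto
    ultimately have "(SUP x\<in>\<Omega>. \<bar>uh x (\<theta> k) - u x\<bar>) \<le> \<epsilon> / 2 + ?L * ?\<Delta>"
      by (intro cSUP_least)
    then show ?thesis
      using half by linarith
  qed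
  then show ?thesis
    by blast
qed

end
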